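(* Let $\mathbb D$ be the unit disc, let $S=\{e^{i\phi}:\alpha\le\phi\le\beta\}$ (with $\alpha<\beta<\alpha+2\pi$) be a proper segment of $\partial\mathbb D$, and let $(a_j)_{j\ge1}$ be a sequence in $\mathbb D\setminus\{0\}$ that satisfies the Blaschke condition $\sum_j(1-|a_j|)<\infty$ and such that $S\subset\overline{\{a_j:j=1,2,\dots\}}$. Let $l\ge0$ be an integer and let $$B(z)=z^l\prod_{j=1}^\infty\frac{|a_j|}{a_j}\,\frac{a_j-z}{1-\overline{a_j}z}$$ be the corresponding Blaschke product, regarded as a holomorphic function on $\mathbb D\cup(\{|z|>1\}\setminus P)$, where $P=\{1/\overline{a_j}:j\ge1\}$ is the set of poles of $B$. Suppose that there exists an increasing sequence of positive numbers $(c_j)_{j\ge1}$ such that $\sum_{j=1}^\infty\frac1{jc_j}$ is finite and $$\Big|a_j-\frac1{\overline{a_j}}\Big|=e^{-jc_j}\qquad\text{for all }j.$$ Then there exists a finely open set $E\subset\mathbb C$ that meets $S$ with the property that $B$ extends as a finely holomorphic function over $E$, i.e. there is a finely holomorphic function on $(\mathbb C\setminus(\partial\mathbb D\cup P))\cup E$ that coincides with $B$ on $\mathbb C\setminus(\partial\mathbb D\cup P)$.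
   Context: The fine topology on $\mathbb C$ is the coarsest topology making all subharmonic functions continuous. A function $f:\Omega\to\mathbb C$ on a finely open set $\Omega$ is finely holomorphic if every $z\in\Omega$ has a fine neighborhood $K_z\subset\Omega$, compact in the Euclidean topology, such that $f|_{K_z}$ is a uniform limit of rational functions with poles off $K_z$. Under the Blaschke condition the product defining $B$ converges locally uniformly on $\mathbb D\cup(\{|z|>1\}\setminus P)$. *)

theory Defs
  imports "HOL-Analysis.Analysis"
begin

text \<open>
  Mean of an extended-real function over the circle of radius \<open>r\<close> about \<open>z\<close>, written as the
  difference of the integrals of its positive and negative parts (\<open>e2ennreal\<close> sends
  negative arguments to \<open>0\<close>). It is used only for upper semicontinuous functions with
  values in \<open>[-\<infinity>, \<infinity>)\<close>: these are bounded above on circles, so the first integral is finite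
  and no difference of infinities occurs; the mean may be \<open>-\<infinity>\<close>.
\<close>

definition circle_mean :: "(complex \<Rightarrow> ereal) \<Rightarrow> complex \<Rightarrow> real \<Rightarrow> ereal" where
  "circle_mean u z r =
     (enn2ereal (\<integral>\<^sup>+t\<in>{0..2 * pi}. e2ennreal (u (z + of_real r * cis t)) \<partial>lborel)
      - enn2ereal (\<integral>\<^sup>+t\<in>{0..2 * pi}. e2ennreal (- u (z + of_real r * cis t)) \<partial>lborel))
     / ereal (2 * pi)"

text \<open>
  Subharmonic functions on the whole plane: upper semicontinuous functions into \<open>[-\<infinity>, \<infinity>)\<close>
  with the sub-mean value property. The constant \<open>-\<infinity>\<close> is admitted; being constant, it has
  no influence on the fine topology.
\<close>

definition subharmonic :: "(complex \<Rightarrow> ereal) \<Rightarrow> bool" where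
  "subharmonic u \<longleftrightarrow>
     (\<forall>z. u z < \<infinity>) \<and>
     (\<forall>c. open {z. u z < c}) \<and>
     (\<forall>z r. 0 < r \<longrightarrow> u z \<le> circle_mean u z r)"

definition fine_topology :: "complex topology" where
  "fine_topology = topology_generated_by {u -` V | u V. subharmonic u \<and> open V}"

abbreviation finely_open :: "complex set \<Rightarrow> bool" where
  "finely_open \<equiv> openin fine_topology"

definition fine_neighborhood :: "complex \<Rightarrow> complex set \<Rightarrow> bool" where
  "fine_neighborhood z K \<longleftrightarrow> (\<exists>U. finely_open U \<and> z \<in> U \<and> U \<subseteq> K)"

definition uniform_limit_of_rationals :: "complex set \<Rightarrow> (complex \<Rightarrow> complex) \<Rightarrow> bool" where
  "uniform_limit_of_rationals K f \<longleftrightarrow>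
     (\<exists>p q :: nat \<Rightarrow> complex poly.
        (\<forall>n. \<forall>w\<in>K. poly (q n) w \<noteq> 0) \<and>
        uniform_limit K (\<lambda>n w. poly (p n) w / poly (q n) w) f sequentially)"

definition finely_holomorphic_on :: "(complex \<Rightarrow> complex) \<Rightarrow> complex set \<Rightarrow> bool" where
  "finely_holomorphic_on f \<Omega> \<longleftrightarrow>
     finely_open \<Omega> \<and>
     (\<forall>z\<in>\<Omega>. \<exists>K\<subseteq>\<Omega>. fine_neighborhood z K \<and> compact K \<and> uniform_limit_of_rationals K f)"

text \<open>
  Sequences are indexed from \<open>1\<close>; the value \<open>a 0\<close> is never used, hence the shift by \<open>Suc\<close>.
\<close>

definition blaschke_product :: "nat \<Rightarrow> (nat \<Rightarrow> complex) \<Rightarrow> complex \<Rightarrow> complex" where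
  "blaschke_product l a z =
     z ^ l * (\<Prod>j. of_real (cmod (a (Suc j))) / a (Suc j) *
                    ((a (Suc j) - z) / (1 - cnj (a (Suc j)) * z)))"

definition blaschke_poles :: "(nat \<Rightarrow> complex) \<Rightarrow> complex set" where
  "blaschke_poles a = (\<lambda>j. 1 / cnj (a j)) ` {1..}"

end

theory Submission
  imports Defs "HOL-Complex_Analysis.Cauchy_Integral_Formula"
begin

text \<open>
  Write \<open>b\<^sub>j = 1 / cnj a\<^sub>j\<close> for the poles and \<open>r\<^sub>j = exp (- j c\<^sub>j / 2)\<close>, so that \<open>\<bar>a\<^sub>j - b\<^sub>j\<bar> = r\<^sub>j\<^sup>2\<close>. Away from
  the discs \<open>D(b\<^sub>j, r\<^sub>j)\<close> the Blaschke product converges uniformly, since \<open>\<Sum> r\<^sub>j < \<infinity>\<close>. These discs are thin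
  at almost every point of the circle: the weights \<open>1 / (j c\<^sub>j)\<close> are summable, so the potential
  \<open>\<Sum> (j c\<^sub>j)\<^sup>-\<^sup>1 ln (\<bar>z - b\<^sub>j\<bar> / 5)\<close> is finite almost everywhere on the circle by the sub-mean value
  property, whereas on \<open>D(b\<^sub>j, r\<^sub>j)\<close> its \<open>j\<close>-th summand alone is at most about \<open>-1/2\<close>. A superlevel set
  of a tail of the potential therefore serves as \<open>E\<close>, and the product itself as the extension. To keep
  the potential real and continuous term by term, \<open>\<bar>z - b\<^sub>j\<bar>\<^sup>2\<close> is replaced by \<open>\<bar>z - b\<^sub>j\<bar>\<^sup>2 + r\<^sub>j\<^sup>2\<close>.
\<close>


section \<open>Circle means of logarithms and continuous subharmonic functions\<close>

text \<open>For \<open>u\<close> in the closed unit disc \<open>1 + l * u\<close> has positive real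
  part, so \<open>Ln (1 + l * u)\<close> is holomorphic there. Its circle mean is the value 0 at the
  centre, and its real part is the logarithm of the modulus.\<close>

lemma has_integral_ln_norm_one_plus:
  fixes l :: complex
  assumes l: "cmod l < 1"
  shows "((\<lambda>t. ln (cmod (1 + l * cis t))) has_integral 0) {0..2 * pi}"
proof -
  have pos: "Re (1 + l * u) > 0" if "cmod u \<le> 1" for u
  proof -
    have "cmod (l * u) < 1"
      using l that mult_left_le[of "cmod u" "cmod l"] by (simp add: norm_mult)
    then show ?thesis
      using abs_Re_le_cmod[of "l * u"] by (simp add: abs_le_iff)
  qed
  have "1 + l * u \<notin> \<real>\<^sub>\<le>\<^sub>0" if "cmod u \<le> 1" for u
    using pos[OF that] complex_nonpos_Reals_iff by auto
  then have "(\<lambda>u. Ln (1 + l * u)) holomorphic_on cball 0 1"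
    by (intro holomorphic_intros) auto
  from Cauchy_integral_circlepath_simple[OF this, of 0]
  have "((\<lambda>t. \<i> * Ln (1 + l * cis t)) has_integral 0) {0..2 * pi}"
    by (simp add: circlepath_def has_contour_integral_part_circlepath_iff mult.commute)
  then have "(Im \<circ> (\<lambda>t. \<i> * Ln (1 + l * cis t)) has_integral 0) {0..2 * pi}"
    by (metis bounded_linear_Im has_integral_linear zero_complex.simps(2))
  then show ?thesis
  proof (rule has_integral_eq[rotated])
    fix t
    have "1 + l * cis t \<noteq> 0"
      using pos[of "cis t"] by (metis norm_cis order_refl order_less_irrefl zero_complex.simps(1))
    then show "(Im \<circ> (\<lambda>t. \<i> * Ln (1 + l * cis t))) t = ln (cmod (1 + l * cis t))"
      by simp
  qed
qed

text \<open>A real-valued working notion: continuity turns the circle mean into an ordinary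
  integral, without the positive and negative parts of \<open>circle_mean\<close>.\<close>

definition continuous_subharmonic :: "(complex \<Rightarrow> real) \<Rightarrow> bool" where
  "continuous_subharmonic f \<longleftrightarrow>
     continuous_on UNIV f \<and>
     (\<forall>z r. 0 < r \<longrightarrow> 2 * pi * f z \<le> integral {0..2 * pi} (\<lambda>t. f (z + of_real r * cis t)))"

lemma continuous_on_circle:
  assumes "continuous_on UNIV (f :: complex \<Rightarrow> real)"
  shows "continuous_on A (\<lambda>t. f (z + of_real r * cis t))"
  by (rule continuous_on_compose2[OF assms]) (auto intro!: continuous_intros)

lemma circle_integrable:
  assumes "continuous_on UNIV (f :: complex \<Rightarrow> real)"
  shows "(\<lambda>t. f (z + of_real r * cis t)) integrable_on {a..b}"
  by (rule integrable_continuous_interval[OF continuous_on_circle[OF assms]])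

lemma continuous_subharmonicD:
  assumes "continuous_subharmonic f"
  shows "continuous_on UNIV f"
    and "0 < r \<Longrightarrow> 2 * pi * f z \<le> integral {0..2 * pi} (\<lambda>t. f (z + of_real r * cis t))"
  using assms by (auto simp: continuous_subharmonic_def)

lemma continuous_subharmonic_const: "continuous_subharmonic (\<lambda>z. k)"
  by (simp add: continuous_subharmonic_def)

lemma continuous_subharmonic_add:
  assumes "continuous_subharmonic f" "continuous_subharmonic g"
  shows "continuous_subharmonic (\<lambda>z. f z + g z)"
  unfolding continuous_subharmonic_def
proof (intro conjI allI impI)
  note c = assms[THEN continuous_subharmonicD(1)]
  show "continuous_on UNIV (\<lambda>z. f z + g z)"
    by (intro continuous_intros c)
  fix z and r :: real assume "0 < r"
  then show "2 * pi * (f z + g z) \<le> integral {0..2 * pi} (\<lambda>t. f (z + of_real r * cis t) + g (z + of_real r * cis t))"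
    using assms[THEN continuous_subharmonicD(2), of r z]
    by (simp add: integral_add circle_integrable c distrib_left)
qed

lemma continuous_subharmonic_cmult:
  assumes f: "continuous_subharmonic f" and "0 \<le> k"
  shows "continuous_subharmonic (\<lambda>z. k * f z)"
  unfolding continuous_subharmonic_def
proof (intro conjI allI impI)
  show "continuous_on UNIV (\<lambda>z. k * f z)"
    by (intro continuous_intros continuous_subharmonicD(1)[OF f])
  fix z and r :: real assume "0 < r"
  then show "2 * pi * (k * f z) \<le> integral {0..2 * pi} (\<lambda>t. k * f (z + of_real r * cis t))"
    using mult_left_mono[OF continuous_subharmonicD(2)[OF f] \<open>0 \<le> k\<close>]
    by (simp add: mult_ac)
qed

lemma continuous_subharmonic_sum:
  assumes "\<And>i. i \<in> I \<Longrightarrow> continuous_subharmonic (f i)"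
  shows "continuous_subharmonic (\<lambda>z. \<Sum>i\<in>I. f i z)"
  using assms
  by (induction I rule: infinite_finite_induct)
    (auto intro: continuous_subharmonic_const continuous_subharmonic_add)

lemma continuous_subharmonic_max:
  assumes "continuous_subharmonic f" "continuous_subharmonic g"
  shows "continuous_subharmonic (\<lambda>z. max (f z) (g z))"
  unfolding continuous_subharmonic_def
proof (intro conjI allI impI)
  note c = assms[THEN continuous_subharmonicD(1)]
  show cm: "continuous_on UNIV (\<lambda>z. max (f z) (g z))"
    by (intro continuous_intros c)
  fix z and r :: real assume r: "0 < r"
  let ?I = "\<lambda>h. integral {0..2 * pi} (\<lambda>t. h (z + of_real r * cis t) :: real)"
  have "?I f \<le> ?I (\<lambda>z. max (f z) (g z))" "?I g \<le> ?I (\<lambda>z. max (f z) (g z))"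
    using circle_integrable[OF c(1)] circle_integrable[OF c(2)] circle_integrable[OF cm]
    by (auto intro!: integral_le)
  then show "2 * pi * max (f z) (g z) \<le> ?I (\<lambda>z. max (f z) (g z))"
    using assms[THEN continuous_subharmonicD(2)[OF _ r, of _ z]] by (auto simp: max_def)
qed

text \<open>
  On the circle, \<open>\<bar>w + r e\<^sup>i\<^sup>t\<bar>\<^sup>2 + e\<^sup>2 = x \<bar>1 + l e\<^sup>i\<^sup>t\<bar>\<^sup>2\<close> where \<open>x\<close> is the larger root of
  \<open>x\<^sup>2 - A x + r\<^sup>2 \<bar>w\<bar>\<^sup>2\<close> for \<open>A = \<bar>w\<bar>\<^sup>2 + e\<^sup>2 + r\<^sup>2\<close>; then \<open>\<bar>l\<bar> < 1\<close>, so the mean of the logarithm is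
  \<open>ln x\<close>. Since the quadratic is nonpositive at \<open>\<bar>w\<bar>\<^sup>2 + e\<^sup>2\<close>, that number is at most \<open>x\<close>.
\<close>

lemma mean_ln_norm_square_ge:
  fixes w :: complex
  assumes r: "0 < r" and e: "0 < e"
  shows "2 * pi * ln ((cmod w)\<^sup>2 + e\<^sup>2) \<le>
         integral {0..2 * pi} (\<lambda>t. ln ((cmod (w + of_real r * cis t))\<^sup>2 + e\<^sup>2))"
proof -
  define A where "A = (cmod w)\<^sup>2 + e\<^sup>2 + r\<^sup>2"
  define B where "B = r * cmod w"
  define D where "D = A\<^sup>2 - 4 * B\<^sup>2"
  define x where "x = (A + sqrt D) / 2"
  define l where "l = of_real r * cnj w / of_real x"
  \<comment> \<open>Since \<open>e\<close> is positive, \<open>2 * B < A\<close> strictly; this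
    gives \<open>D > 0\<close> and \<open>B < x\<close>, hence
    \<open>cmod l = B / x < 1\<close>.\<close>
  have "A - 2 * B = (cmod w - r)\<^sup>2 + e\<^sup>2"
    by (simp add: A_def B_def power2_eq_square algebra_simps)
  also have "0 < \<dots>"
    using e by (intro add_nonneg_pos) auto
  finally have AB: "2 * B < A" by simp
  have B0: "0 \<le> B"
    using r by (simp add: B_def)
  have D: "0 < D"
    using AB B0 power_strict_mono[of "2 * B" A 2] by (simp add: D_def power_mult_distrib)
  have sqrt_D: "0 < sqrt D" using D by simp
  have Bx: "B < x" unfolding x_def using add_strict_mono[OF AB sqrt_D] by simp
  then have x0: "0 < x" using B0 by simp
  have root: "x\<^sup>2 + B\<^sup>2 = A * x"
  proof -
    have "(sqrt D)\<^sup>2 = D" using D by simp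
    then show ?thesis
      by (simp add: x_def D_def power2_eq_square field_simps)
  qed
  have Xx: "(cmod w)\<^sup>2 + e\<^sup>2 \<le> x"
  proof (rule ccontr)
    let ?X = "(cmod w)\<^sup>2 + e\<^sup>2"
    assume "\<not> ?X \<le> x"
    then have less: "x < ?X" by simp
    have "A / 2 \<le> x" using sqrt_D by (simp add: x_def)
    then have "0 < (?X - x) * (?X + x - A)"
      using less by (intro mult_pos_pos) auto
    also have "\<dots> = ?X\<^sup>2 - A * ?X + B\<^sup>2"
      using root by (simp add: power2_eq_square algebra_simps)
    also have "\<dots> = - (r\<^sup>2 * e\<^sup>2)"
      by (simp add: A_def B_def power2_eq_square algebra_simps)
    finally show False by (simp add: mult_less_0_iff)
  qed
  have norm_l: "cmod l = B / x"
    using r x0 by (simp add: l_def B_def norm_mult norm_divide)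
  then have l: "cmod l < 1"
    using Bx x0 by simp
  have fac: "(cmod (w + of_real r * cis t))\<^sup>2 + e\<^sup>2 = x * (cmod (1 + l * cis t))\<^sup>2" for t
  proof -
    have "(cmod (w + of_real r * cis t))\<^sup>2 + e\<^sup>2 = A + 2 * r * Re (cnj w * cis t)"
    proof -
      have "(cmod (w + of_real r * cis t))\<^sup>2 = (cmod w)\<^sup>2 + r\<^sup>2 * ((cos t)\<^sup>2 + (sin t)\<^sup>2) + 2 * r * Re (cnj w * cis t)"
        unfolding cmod_power2
        by (simp add: power2_eq_square algebra_simps del: sin_cos_squared_add2 sin_cos_squared_add3)
      then show ?thesis by (simp add: A_def)
    qed
    moreover have "x * (cmod (1 + l * cis t))\<^sup>2 = x * (1 + (cmod l)\<^sup>2) + 2 * (x * Re (l * cis t))"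
    proof -
      have "(cmod (1 + l * cis t))\<^sup>2 = 1 + (cmod l)\<^sup>2 * ((cos t)\<^sup>2 + (sin t)\<^sup>2) + 2 * Re (l * cis t)"
        unfolding cmod_power2
        by (simp add: power2_eq_square algebra_simps del: sin_cos_squared_add2 sin_cos_squared_add3)
      then show ?thesis by (simp add: distrib_left)
    qed
    moreover have "x * (1 + (cmod l)\<^sup>2) = A"
      using root x0 by (simp add: norm_l power_divide power2_eq_square field_simps)
    moreover have "x * Re (l * cis t) = r * Re (cnj w * cis t)"
    proof -
      have "of_real x * (l * cis t) = of_real r * (cnj w * cis t)"
        using x0 by (simp add: l_def)
      from arg_cong[where f=Re, OF this] show ?thesis by simp
    qed
    ultimately show ?thesis by simp
  qed
  have "((\<lambda>t. ln x + 2 * ln (cmod (1 + l * cis t))) has_integral (2 * pi * ln x + 2 * 0)) {0..2 * pi}"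
    using has_integral_const_real[of "ln x" 0 "2 * pi"]
    by (intro has_integral_add has_integral_mult_right has_integral_ln_norm_one_plus[OF l]) auto
  then have "((\<lambda>t. ln ((cmod (w + of_real r * cis t))\<^sup>2 + e\<^sup>2)) has_integral (2 * pi * ln x + 2 * 0)) {0..2 * pi}"
  proof (rule has_integral_eq[rotated])
    fix t
    have "cmod (l * cis t) < 1" using l by (simp add: norm_mult)
    then have "1 + l * cis t \<noteq> 0"
      by (metis add_eq_0_iff norm_minus_cancel norm_one order_less_irrefl)
    then show "ln x + 2 * ln (cmod (1 + l * cis t)) = ln ((cmod (w + of_real r * cis t))\<^sup>2 + e\<^sup>2)"
      using x0 by (simp add: fac ln_mult ln_realpow)
  qed
  moreover have "ln ((cmod w)\<^sup>2 + e\<^sup>2) \<le> ln x"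
    using Xx e by (intro ln_mono) (auto intro: add_nonneg_pos)
  ultimately show ?thesis
    by (simp add: integral_unique)
qed

lemma continuous_subharmonic_ln:
  assumes e: "0 < e"
  shows "continuous_subharmonic (\<lambda>z. ln ((cmod (z - b))\<^sup>2 + e\<^sup>2))"
  unfolding continuous_subharmonic_def
proof (intro conjI allI impI)
  have "(cmod (z - b))\<^sup>2 + e\<^sup>2 \<noteq> 0" for z
    using e by (simp add: sum_power2_eq_zero_iff)
  then show "continuous_on UNIV (\<lambda>z. ln ((cmod (z - b))\<^sup>2 + e\<^sup>2))"
    by (intro continuous_intros) auto
  fix z and r :: real assume "0 < r"
  from mean_ln_norm_square_ge[OF this e, of "z - b"]
  show "2 * pi * ln ((cmod (z - b))\<^sup>2 + e\<^sup>2) \<le> integral {0..2 * pi} (\<lambda>t. ln ((cmod (z + of_real r * cis t - b))\<^sup>2 + e\<^sup>2))"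
    by (simp add: add_diff_eq diff_add_eq)
qed

section \<open>Passage to extended-real subharmonic functions and the fine topology\<close>

lemma circle_mean_real:
  fixes u :: "complex \<Rightarrow> real"
  assumes u: "u \<in> borel_measurable borel"
    and bdd: "\<And>t. t \<in> {0..2 * pi} \<Longrightarrow> \<bar>u (z + of_real r * cis t)\<bar> \<le> C"
  shows "circle_mean (\<lambda>z. ereal (u z)) z r =
         ereal (integral {0..2 * pi} (\<lambda>t. u (z + of_real r * cis t)) / (2 * pi))"
proof -
  define h where "h t = u (z + of_real r * cis t)" for t
  have cis: "(\<lambda>t. z + of_real r * cis t) \<in> borel_measurable borel"
    by (intro borel_measurable_continuous_onI continuous_intros)
  have [measurable]: "h \<in> borel_measurable borel"
    unfolding h_def by (rule measurable_compose[OF cis u])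
  have int: "set_integrable lborel {0..2 * pi} h"
    unfolding set_integrable_def
    by (rule Bochner_Integration.integrable_bound[OF integrable_real_indicator[of "{0..2*pi}" lborel, THEN integrable_mult_right[of C]]])
      (auto simp: abs_mult h_def[symmetric] intro!: AE_I2 mult_left_mono order_trans[OF bdd[folded h_def]] split: split_indicator)
  have nn: "(\<integral>\<^sup>+t\<in>{0..2 * pi}. e2ennreal (ereal (f t)) \<partial>lborel) = (\<integral>\<^sup>+t. ennreal (indicator {0..2 * pi} t * f t) \<partial>lborel)" for f
    by (rule nn_integral_cong) (simp split: split_indicator)
  let ?p = "\<integral>\<^sup>+t. ennreal (indicator {0..2 * pi} t * h t) \<partial>lborel"
  let ?n = "\<integral>\<^sup>+t. ennreal (indicator {0..2 * pi} t * - h t) \<partial>lborel"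
  have int': "integrable lborel (\<lambda>t. indicator {0..2 * pi} t * h t)"
    using int by (simp add: set_integrable_def)
  have fin: "?p \<noteq> \<infinity>" "?n \<noteq> \<infinity>"
    using int' by (simp_all add: real_integrable_def)
  have "integral {0..2 * pi} h = enn2real ?p - enn2real ?n"
    using set_borel_integral_eq_integral(2)[OF int] real_lebesgue_integral_def[OF int']
    by (simp add: set_lebesgue_integral_def)
  then have eq: "ereal (integral {0..2 * pi} h) = enn2ereal ?p - enn2ereal ?n"
    using fin by (cases ?p; cases ?n) (auto simp: enn2ereal_ennreal)
  show ?thesis
    unfolding circle_mean_def nn uminus_ereal.simps h_def[symmetric] eq[symmetric] by simp
qed

text \<open>Upper semicontinuity survives because a sublevel set of the limit is the union of those
  of the approximants; the mean inequality survives by monotone convergence. The bounds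
  \<open>k\<close> and \<open>f 0\<close> keep the limit bounded on circles, as
  \<open>circle_mean_real\<close> requires.\<close>

lemma decreasing_limit_subharmonic:
  assumes f: "\<And>n. continuous_subharmonic (f n)"
    and dec: "\<And>n z. f (Suc n) z \<le> f n z"
    and lim: "\<And>z. (\<lambda>n. f n z) \<longlonglongrightarrow> u z"
    and lower: "\<And>z. k \<le> u z"
  shows "subharmonic (\<lambda>z. ereal (u z))"
  unfolding subharmonic_def
proof (intro conjI allI impI)
  note cont = continuous_subharmonicD(1)[OF f]
  have u_le: "u z \<le> f n z" for n z
    by (rule decseq_ge[of "\<lambda>n. f n z", OF _ lim]) (simp add: decseq_Suc_iff dec)
  have meas: "u \<in> borel_measurable borel"
    by (rule borel_measurable_LIMSEQ_real[OF lim]) (intro borel_measurable_continuous_onI cont)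
  show "ereal (u z) < \<infinity>" for z by simp
  show "open {z. ereal (u z) < c}" for c
  proof -
    have "{z. ereal (u z) < c} = (\<Union>n. {z. ereal (f n z) < c})"
    proof safe
      fix z assume "ereal (u z) < c"
      then have "\<forall>\<^sub>F n in sequentially. ereal (f n z) < c"
        using lim[of z] by (intro order_tendstoD(2)[of "\<lambda>n. ereal (f n z)" "ereal (u z)"]) auto
      then show "z \<in> (\<Union>n. {z. ereal (f n z) < c})"
        by (auto simp: eventually_sequentially)
    next
      fix z n assume "ereal (f n z) < c"
      then show "ereal (u z) < c"
        using u_le[of z n] by (intro le_less_trans[of "ereal (u z)" "ereal (f n z)"]) simp_all
    qed
    moreover have "open {z. ereal (f n z) < c}" for n
      using cont[of n] by (intro open_Collect_less continuous_on_ereal continuous_intros) auto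
    ultimately show ?thesis by auto
  qed
  fix z and r :: real assume r: "0 < r"
  let ?h = "\<lambda>g t. g (z + of_real r * cis t) :: real"
  let ?I = "\<lambda>g. integral {0..2 * pi} (?h g)"
  have dec0: "f n z \<le> f 0 z" for n z
    by (induction n) (auto intro: order_trans[OF dec])
  have le0: "?I (f n) \<le> ?I (f 0)" for n
    by (intro integral_le circle_integrable cont dec0)
  have ge: "2 * pi * u z \<le> ?I (f n)" for n
    by (rule order_trans[OF mult_left_mono[OF u_le] continuous_subharmonicD(2)[OF f r]]) simp
  have "bounded (range (\<lambda>n. ?I (f n)))"
    by (rule bounded_subset[OF bounded_closed_interval[of "2 * pi * u z" "?I (f 0)"]]) (use le0 ge in auto)
  then have "(\<lambda>n. ?I (f n)) \<longlonglongrightarrow> ?I u"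
    using monotone_convergence_decreasing[of "\<lambda>n. ?h (f n)" "{0..2 * pi}" "?h u"]
    by (auto intro: circle_integrable cont dec lim)
  then have "2 * pi * u z \<le> ?I u"
    using ge by (intro LIMSEQ_le_const) auto
  have "bounded (?h (f 0) ` {0..2 * pi})"
    by (intro compact_imp_bounded compact_continuous_image continuous_on_circle cont compact_Icc)
  then obtain C where C: "\<forall>t\<in>{0..2 * pi}. \<bar>?h (f 0) t\<bar> \<le> C"
    unfolding bounded_iff by auto
  have "\<bar>?h u t\<bar> \<le> C + \<bar>k\<bar>" if "t \<in> {0..2 * pi}" for t
    using bspec[OF C that] u_le[of "z + of_real r * cis t" 0] lower[of "z + of_real r * cis t"]
    by linarith
  from circle_mean_real[OF meas this] \<open>2 * pi * u z \<le> ?I u\<close>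
  show "ereal (u z) \<le> circle_mean (\<lambda>z. ereal (u z)) z r"
    by (simp add: pos_le_divide_eq mult.commute)
qed

lemma finely_open_superlevel:
  assumes "subharmonic (\<lambda>z. ereal (u z))"
  shows "finely_open {z. k < u z}"
proof -
  have "{z. k < u z} = (\<lambda>z. ereal (u z)) -` {ereal k<..}" by auto
  then show ?thesis
    using assms unfolding fine_topology_def
    by (metis (mono_tags, lifting) mem_Collect_eq open_greaterThan topology_generated_by_Basis)
qed

text \<open>A disc about \<open>b\<close> is a sublevel set of the subharmonic function ln (|z -
  b|^2 + 1), and discs form a basis.\<close>

lemma open_imp_finely_open:
  assumes "open U"
  shows "finely_open U"
proof (subst openin_subopen, rule ballI)
  fix b assume "b \<in> U"
  then obtain s where s: "0 < s" "ball b s \<subseteq> U"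
    using assms open_contains_ball by blast
  let ?u = "\<lambda>z. ln ((cmod (z - b))\<^sup>2 + 1\<^sup>2)"
  have "subharmonic (\<lambda>z. ereal (?u z))"
    by (rule decreasing_limit_subharmonic[of "\<lambda>n. ?u" _ 0]) (rule continuous_subharmonic_ln, auto)
  note sub = this
  then have "finely_open ((\<lambda>z. ereal (?u z)) -` {..<ereal (ln (s\<^sup>2 + 1))})"
    unfolding fine_topology_def
    by (intro topology_generated_by_Basis CollectI exI conjI refl sub) auto
  moreover have "(\<lambda>z. ereal (?u z)) -` {..<ereal (ln (s\<^sup>2 + 1))} = ball b s"
  proof -
    have "?u z < ln (s\<^sup>2 + 1) \<longleftrightarrow> dist b z < s" for z
    proof -
      have "?u z < ln (s\<^sup>2 + 1) \<longleftrightarrow> (cmod (z - b))\<^sup>2 < s\<^sup>2"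
        by (subst ln_less_cancel_iff) (auto intro: add_nonneg_pos)
      also have "\<dots> \<longleftrightarrow> dist b z < s"
        using s(1) unfolding not_le[symmetric] by (simp add: dist_norm norm_minus_commute)
      finally show ?thesis .
    qed
    then show ?thesis by (auto simp: mem_ball)
  qed
  ultimately show "\<exists>T. finely_open T \<and> b \<in> T \<and> T \<subseteq> U"
    using s by (intro exI[of _ "ball b s"]) auto
qed

section \<open>Logarithmic potentials concentrated at the poles\<close>

text \<open>A smoothing of w_n ln (|z - b_n| / 5): the half undoes the squares, and 25 is 5 squared.
  On the disc of radius 2 the argument of the first logarithm is at most 17, so subtracting
  \<open>ln 25\<close> makes the summand nonpositive there.\<close>

definition weighted_log :: "(nat \<Rightarrow> complex) \<Rightarrow> (nat \<Rightarrow> real) \<Rightarrow> (nat \<Rightarrow> real) \<Rightarrow> nat \<Rightarrow> complex \<Rightarrow> real" where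
  "weighted_log b r w n z = w n / 2 * (ln ((cmod (z - b n))\<^sup>2 + (r n)\<^sup>2) - ln 25)"

context
  fixes b :: "nat \<Rightarrow> complex" and r w :: "nat \<Rightarrow> real"
  assumes b_le: "\<And>n. cmod (b n) \<le> 2" and r_pos: "\<And>n. 0 < r n" and r_le: "\<And>n. r n \<le> 1"
    and w_nonneg: "\<And>n. 0 \<le> w n" and w_summable: "summable w"
begin

lemma continuous_subharmonic_weighted_log: "continuous_subharmonic (weighted_log b r w n)"
proof -
  have "continuous_subharmonic (\<lambda>z. w n / 2 * (ln ((cmod (z - b n))\<^sup>2 + (r n)\<^sup>2) + - ln 25))"
    by (intro continuous_subharmonic_cmult continuous_subharmonic_add
        continuous_subharmonic_const continuous_subharmonic_ln r_pos) (simp add: w_nonneg)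
  then show ?thesis
    unfolding weighted_log_def[abs_def] by simp
qed

lemma weighted_log_nonpos:
  assumes "cmod z \<le> 2"
  shows "weighted_log b r w n z \<le> 0"
proof -
  have "cmod (z - b n) \<le> 4"
    using norm_triangle_ineq4[of z "b n"] assms b_le[of n] by simp
  then have "(cmod (z - b n))\<^sup>2 + (r n)\<^sup>2 \<le> 4\<^sup>2 + 1\<^sup>2"
    using r_pos[of n] r_le[of n] by (intro add_mono power_mono) auto
  moreover have "0 < (cmod (z - b n))\<^sup>2 + (r n)\<^sup>2"
    using r_pos[of n] by (intro add_nonneg_pos) auto
  ultimately have "ln ((cmod (z - b n))\<^sup>2 + (r n)\<^sup>2) \<le> ln 25"
    by (intro ln_mono) auto
  then show ?thesis
    using w_nonneg[of n] by (simp add: weighted_log_def mult_nonneg_nonpos)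
qed

text \<open>Far from the origin the summands may be positive. This majorant is a fixed function
  times the summable coefficient \<open>w n\<close>, so its tails vanish in the limit.\<close>

lemma weighted_log_le:
  "weighted_log b r w n z \<le> w n * (ln ((cmod z)\<^sup>2 + 1) / 2)"
proof -
  have "cmod (z - b n) \<le> cmod z + 2"
    using norm_triangle_ineq4[of z "b n"] b_le[of n] by simp
  then have "(cmod (z - b n))\<^sup>2 + (r n)\<^sup>2 \<le> (cmod z + 2)\<^sup>2 + 1\<^sup>2"
    using r_pos[of n] r_le[of n] by (intro add_mono power_mono) auto
  \<comment> \<open>By the parallelogram identity (|z| + 2)^2 is at most 2 |z|^2 + 8.\<close>
  also have "\<dots> \<le> 25 * ((cmod z)\<^sup>2 + 1)"
  proof -
    have "(cmod z - 2)\<^sup>2 + (cmod z + 2)\<^sup>2 = 2 * (cmod z)\<^sup>2 + 8"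
      by (simp add: power2_eq_square algebra_simps)
    then show ?thesis
      using zero_le_power2[of "cmod z - 2"] zero_le_power2[of "cmod z"]
      unfolding power_one distrib_left by linarith
  qed
  finally have "ln ((cmod (z - b n))\<^sup>2 + (r n)\<^sup>2) \<le> ln (25 * ((cmod z)\<^sup>2 + 1))"
    using r_pos[of n] by (intro ln_mono) (auto intro!: add_nonneg_pos)
  also have "\<dots> = ln 25 + ln ((cmod z)\<^sup>2 + 1)"
    by (intro ln_mult_pos) (auto intro: add_nonneg_pos)
  finally show ?thesis
    using mult_left_mono[OF _ w_nonneg[of n]] unfolding weighted_log_def by fastforce
qed

text \<open>
  The potential \<open>\<Sum>n. weighted_log b r w n\<close>, cut off at \<open>-1\<close>. The partial sums of its tails decrease
  only where the summands are negative; adding the majorant of the remaining summands makes the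
  approximation decrease in the whole plane.
\<close>

lemma exists_subharmonic_avoiding:
  assumes z0: "cmod z0 \<le> 2" and sum: "summable (\<lambda>n. weighted_log b r w n z0)" and "e > 0"
  shows "\<exists>N u. subharmonic (\<lambda>z. ereal (u z)) \<and> - e < u z0 \<and>
    (\<forall>z n. cmod z \<le> 2 \<longrightarrow> - e < u z \<longrightarrow> N \<le> n \<longrightarrow> - e < max (weighted_log b r w n z) (- 1))"
proof -
  let ?v = "weighted_log b r w"
  let ?L = "\<Sum>n. ?v n z0"
  \<comment> \<open>\<open>N\<close> is chosen so that the tail of the potential at
    \<open>z0\<close> from index \<open>N\<close> on exceeds \<open>- e\<close>.\<close>
  have "(\<lambda>N. ?L - (\<Sum>j<N. ?v j z0)) \<longlonglongrightarrow> ?L - ?L"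
    by (intro tendsto_intros summable_LIMSEQ sum)
  then have "\<forall>\<^sub>F N in sequentially. - e < ?L - (\<Sum>j<N. ?v j z0)"
    using \<open>e > 0\<close> by (intro order_tendstoD(1)) auto
  then obtain N where N: "- e < ?L - (\<Sum>j<N. ?v j z0)"
    by (auto simp: eventually_sequentially)
  \<comment> \<open>\<open>T n\<close> is the total weight of the summands not yet in
    \<open>s n\<close>, those from index \<open>n + N\<close> on; \<open>T n * g z\<close> majorises
    their sum.\<close>
  define T where "T n = (\<Sum>j. w j) - (\<Sum>j<n + N. w j)" for n
  define g where "g z = ln ((cmod z)\<^sup>2 + 1) / 2" for z
  define s where "s n z = (\<Sum>j<n. ?v (j + N) z)" for n z
  define f where "f n z = max (s n z) (- 1) + T n * g z" for n z
  have T_nonneg: "0 \<le> T n" for n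
    unfolding T_def using sum_le_suminf[OF w_summable, of "{..<n + N}"] w_nonneg by simp
  have T_Suc: "T (Suc n) = T n - w (n + N)" for n
    by (simp add: T_def)
  have "T \<longlonglongrightarrow> (\<Sum>j. w j) - (\<Sum>j. w j)"
    unfolding T_def[abs_def]
    by (intro tendsto_intros LIMSEQ_ignore_initial_segment summable_LIMSEQ w_summable)
  then have T_lim: "T \<longlonglongrightarrow> 0" by simp
  have g_nonneg: "0 \<le> g z" for z
    by (simp add: g_def)
  have g_sub: "continuous_subharmonic g"
    using continuous_subharmonic_cmult[OF continuous_subharmonic_ln[of 1 0], of "1/2"]
    by (simp add: g_def[abs_def])
  have f_sub: "continuous_subharmonic (f n)" for n
    unfolding f_def[abs_def] s_def[abs_def]
    by (intro continuous_subharmonic_add continuous_subharmonic_max continuous_subharmonic_sum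
        continuous_subharmonic_const continuous_subharmonic_cmult g_sub T_nonneg
        continuous_subharmonic_weighted_log)
  have f_dec: "f (Suc n) z \<le> f n z" for n z
  proof -
    \<comment> \<open>The new summand is at most \<open>w (n + N) * g z\<close>, exactly what the
      correction \<open>T n * g z\<close> loses.\<close>
    have "s (Suc n) z \<le> s n z + w (n + N) * g z"
      using weighted_log_le[of "n + N" z] by (simp add: s_def g_def)
    moreover have "0 \<le> w (n + N) * g z"
      using w_nonneg g_nonneg by simp
    ultimately show ?thesis
      unfolding f_def T_Suc left_diff_distrib by (auto simp: max_def)
  qed
  have f_ge: "- 1 \<le> f n z" for n z
    unfolding f_def using mult_nonneg_nonneg[OF T_nonneg g_nonneg, of n z] by linarith
  define u where "u z = lim (\<lambda>n. f n z)" for z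
  have f_lim: "(\<lambda>n. f n z) \<longlonglongrightarrow> u z" for z
  proof -
    have "decseq (\<lambda>n. f n z)" by (simp add: decseq_Suc_iff f_dec)
    then obtain L where "(\<lambda>n. f n z) \<longlonglongrightarrow> L"
      using f_ge by (elim decseq_convergent[where B="- 1"]) auto
    then show ?thesis
      unfolding u_def by (simp add: limI)
  qed
  have "subharmonic (\<lambda>z. ereal (u z))"
    by (rule decreasing_limit_subharmonic[OF f_sub f_dec f_lim]) (rule LIMSEQ_le_const[OF f_lim], use f_ge in blast)
  moreover have "- e < u z0"
  proof -
    \<comment> \<open>At \<open>z0\<close> all summands are nonpositive, so every partial sum of the
      tail dominates the whole tail.\<close>
    have "?L - (\<Sum>j<N. ?v j z0) \<le> f n z0" for n
    proof -
      have "- (\<Sum>j<n + N. ?v j z0) = (\<Sum>j<n + N. - ?v j z0)" by (simp add: sum_negf)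
      also have "\<dots> \<le> (\<Sum>j. - ?v j z0)"
        using weighted_log_nonpos[OF z0] by (intro sum_le_suminf summable_minus sum) auto
      also have "\<dots> = - ?L" by (rule suminf_minus[OF sum])
      finally have "?L - (\<Sum>j<N. ?v j z0) \<le> (\<Sum>j<n + N. ?v j z0) - (\<Sum>j<N. ?v j z0)" by simp
      also have "\<dots> = s n z0"
        unfolding s_def by (induction n) auto
      also have "\<dots> \<le> f n z0"
        using mult_nonneg_nonneg[OF T_nonneg g_nonneg, of n z0] by (simp add: f_def)
      finally show ?thesis .
    qed
    then have "?L - (\<Sum>j<N. ?v j z0) \<le> u z0"
      by (intro LIMSEQ_le_const[OF f_lim]) auto
    with N show ?thesis by simp
  qed
  \<comment> \<open>For \<open>m > n\<close> the sum \<open>s m z\<close> contains summand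
    \<open>n\<close>, at position \<open>n - N\<close>. Dropping the others, which are nonpositive
    here, leaves a bound that tends to \<open>max (?v n z) (- 1)\<close>.\<close>
  moreover have "u z \<le> max (?v n z) (- 1)" if "cmod z \<le> 2" "N \<le> n" for z n
  proof (rule LIMSEQ_le[OF f_lim])
    have "(\<lambda>m. max (?v n z) (- 1) + T m * g z) \<longlonglongrightarrow> max (?v n z) (- 1) + 0 * g z"
      by (intro tendsto_intros T_lim)
    then show "(\<lambda>m. max (?v n z) (- 1) + T m * g z) \<longlonglongrightarrow> max (?v n z) (- 1)"
      by simp
    have "f m z \<le> max (?v n z) (- 1) + T m * g z" if "n < m" for m
    proof -
      have "n - N \<in> {..<m}" using that by simp
      then have "s m z = ?v (n - N + N) z + (\<Sum>j\<in>{..<m} - {n - N}. ?v (j + N) z)"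
        unfolding s_def by (subst sum.remove) auto
      also have "\<dots> \<le> ?v n z"
        using weighted_log_nonpos[OF \<open>cmod z \<le> 2\<close>] \<open>N \<le> n\<close> by (simp add: sum_nonpos)
      finally show ?thesis by (simp add: f_def)
    qed
    then show "\<exists>M. \<forall>m\<ge>M. f m z \<le> max (?v n z) (- 1) + T m * g z"
      by (intro exI[of _ "Suc n"]) auto
  qed
  ultimately show ?thesis
    by (intro exI[of _ N] exI[of _ u]) (meson less_le_trans)
qed

text \<open>At the centre 0 the summands are bounded below because
  \<open>1 \<le> cmod (b n)\<close>, so the sub-mean value inequality bounds the integral of the
  negated summand by a multiple of \<open>w n\<close>. Tonelli gives summability almost everywhere
  on the circle, and the arc has positive length.\<close>

lemma exists_summable_on_arc:
  assumes b_ge: "\<And>n. 1 \<le> cmod (b n)" and "\<alpha> < \<beta>" "\<beta> < \<alpha> + 2 * pi"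
  shows "\<exists>t\<in>{\<alpha>..\<beta>}. summable (\<lambda>n. weighted_log b r w n (cis t))"
proof -
  \<comment> \<open>Angles are measured from \<open>\<alpha>\<close>, so that the arc becomes the
    initial piece \<open>{0..\<beta> - \<alpha>}\<close> of \<open>{0..2 * pi}\<close>.\<close>
  define h where "h n t = - weighted_log b r w n (cis (\<alpha> + t))" for n t
  have h_nonneg: "0 \<le> h n t" for n t
    using weighted_log_nonpos[of "cis (\<alpha> + t)" n] by (simp add: h_def)
  have h_cont: "continuous_on A (h n)" for A n
    unfolding h_def[abs_def]
    by (intro continuous_intros
        continuous_on_compose2[OF continuous_subharmonicD(1)[OF continuous_subharmonic_weighted_log]]) auto
  have [measurable]: "h n \<in> borel_measurable borel" for n
    by (intro borel_measurable_continuous_onI h_cont)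
  have int_le: "integral {0..2 * pi} (h n) \<le> w n * (pi * ln 25)" for n
  proof -
    \<comment> \<open>Rotating the poles by \<open>- \<alpha>\<close> restores the standard
      parametrisation of the circle and leaves their moduli unchanged.\<close>
    let ?b = "\<lambda>n. cis (- \<alpha>) * b n"
    have rot: "cmod (cis (\<alpha> + t) - b n) = cmod (0 + of_real 1 * cis t - ?b n)" for t
    proof -
      have "cis (\<alpha> + t) - b n = cis \<alpha> * (cis t - ?b n)"
        by (simp add: cis_mult right_diff_distrib mult.assoc[symmetric])
      then show ?thesis by (simp add: norm_mult)
    qed
    have eq: "weighted_log b r w n (cis (\<alpha> + t)) = weighted_log ?b r w n (0 + of_real 1 * cis t)" for t
      unfolding weighted_log_def rot ..
    have "continuous_subharmonic (\<lambda>z. w n / 2 * (ln ((cmod (z - ?b n))\<^sup>2 + (r n)\<^sup>2) + - ln 25))"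
      by (intro continuous_subharmonic_cmult continuous_subharmonic_add
          continuous_subharmonic_const continuous_subharmonic_ln r_pos) (simp add: w_nonneg)
    then have "continuous_subharmonic (weighted_log ?b r w n)"
      unfolding weighted_log_def[abs_def] by simp
    from continuous_subharmonicD(2)[OF this, of 1 0]
    have "2 * pi * weighted_log ?b r w n 0 \<le> - integral {0..2 * pi} (h n)"
      by (simp add: h_def[abs_def] eq)
    moreover have "- (w n * ln 25) \<le> 2 * weighted_log ?b r w n 0"
    proof -
      have "0 \<le> ln ((cmod (b n))\<^sup>2 + (r n)\<^sup>2)"
        using power_mono[OF b_ge[of n], of 2] by (intro ln_ge_zero) (simp add: add_increasing2)
      then have "w n * - ln 25 \<le> w n * (ln ((cmod (b n))\<^sup>2 + (r n)\<^sup>2) - ln 25)"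
        by (intro mult_left_mono w_nonneg) auto
      then show ?thesis by (simp add: weighted_log_def norm_mult)
    qed
    then have "pi * - (w n * ln 25) \<le> pi * (2 * weighted_log ?b r w n 0)"
      by (intro mult_left_mono) auto
    ultimately show ?thesis by (simp add: algebra_simps)
  qed
  let ?J = "{0..2 * pi}"
  have nn: "(\<integral>\<^sup>+t. ennreal (indicator ?J t * h n t) \<partial>lborel) \<le> ennreal (w n * (pi * ln 25))" for n
  proof -
    have "(h n has_integral integral ?J (h n)) ?J"
      by (intro integrable_integral integrable_continuous_interval h_cont)
    then have "((\<lambda>t. if t \<in> ?J then h n t else 0) has_integral integral ?J (h n)) UNIV"
      by (simp only: has_integral_restrict_UNIV)
    then have "((\<lambda>t. indicator ?J t * h n t) has_integral integral ?J (h n)) UNIV"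
      by (rule has_integral_eq[rotated]) (simp add: indicator_def)
    then have "(\<integral>\<^sup>+t. ennreal (indicator ?J t * h n t) \<partial>lborel) = ennreal (integral ?J (h n))"
      using h_nonneg by (intro nn_integral_has_integral_lborel) auto
    then show ?thesis using int_le by (simp add: ennreal_leI)
  qed
  have "(\<integral>\<^sup>+t. (\<Sum>n. ennreal (indicator ?J t * h n t)) \<partial>lborel)
      = (\<Sum>n. \<integral>\<^sup>+t. ennreal (indicator ?J t * h n t) \<partial>lborel)"
    by (intro nn_integral_suminf) auto
  also have "\<dots> \<le> (\<Sum>n. ennreal (w n * (pi * ln 25)))"
    by (intro suminf_le nn) auto
  also have "\<dots> = ennreal (\<Sum>n. w n * (pi * ln 25))"
    by (intro suminf_ennreal2 mult_nonneg_nonneg w_nonneg summable_mult2 w_summable) auto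
  also have "\<dots> < \<infinity>" by simp
  finally have "AE t in lborel. (\<Sum>n. ennreal (indicator ?J t * h n t)) \<noteq> \<infinity>"
    by (intro nn_integral_PInf_AE) auto
  then have AE: "AE t in lborel. t \<in> ?J \<longrightarrow> summable (\<lambda>n. h n t)"
  proof eventually_elim
    case (elim t)
    then show ?case
      by (auto intro!: summable_suminf_not_top h_nonneg)
  qed
  have "\<exists>t\<in>{0..\<beta> - \<alpha>}. summable (\<lambda>n. h n t)"
  proof (rule ccontr)
    assume "\<not> ?thesis"
    then have "AE t in lborel. t \<notin> {0..\<beta> - \<alpha>}"
      using AE assms(3) by (auto elim!: eventually_mono)
    then have "emeasure lborel {0..\<beta> - \<alpha>} = 0"
      by (simp add: AE_iff_measurable[OF _ refl] flip: atLeastAtMost_iff)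
    then show False using assms(2) by simp
  qed
  then obtain t where t: "t \<in> {0..\<beta> - \<alpha>}" "summable (\<lambda>n. h n t)" by blast
  then have "summable (\<lambda>n. weighted_log b r w n (cis (\<alpha> + t)))"
    using summable_minus[OF t(2)] by (simp add: h_def)
  with t(1) show ?thesis
    by (intro bexI[of _ "\<alpha> + t"]) auto
qed

end

section \<open>Compact superlevel sets and rational approximation of the Blaschke product\<close>

text \<open>Upper semicontinuity makes superlevel sets closed in the Euclidean sense. They supply
  the compact fine neighborhoods that \<open>finely_holomorphic_on\<close> asks for.\<close>

lemma compact_superlevel:
  assumes "subharmonic (\<lambda>z. ereal (u z))"
  shows "compact ({z. s \<le> u z} \<inter> cball z0 d)"
proof -
  have "open {z. ereal (u z) < ereal s}"
    using assms unfolding subharmonic_def by blast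
  then have "closed (- {z. ereal (u z) < ereal s})" by (rule closed_Compl)
  moreover have "- {z. ereal (u z) < ereal s} = {z. s \<le> u z}" by auto
  ultimately show ?thesis by (simp add: closed_Int_compact)
qed

text \<open>Splits off the pole: the first term compares the gap between zero and pole with the
  distance to the pole, the second is constant in \<open>z\<close> and controlled by the Blaschke
  condition.\<close>

lemma blaschke_factor_minus_one:
  fixes a z :: complex
  assumes a: "a \<noteq> 0" and z: "z \<noteq> 1 / cnj a"
  shows "of_real (cmod a) / a * ((a - z) / (1 - cnj a * z)) - 1 =
         (a - 1 / cnj a) / (of_real (cmod a) * (1 / cnj a - z)) + of_real ((1 - cmod a) / cmod a)"
proof -
  define b where "b = 1 / cnj a"
  define m where "m = complex_of_real (cmod a)"
  have m: "m \<noteq> 0" and ab: "1 - cnj a * z = cnj a * (b - z)" and bz: "b - z \<noteq> 0"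
    using a z by (auto simp: m_def b_def field_simps)
  have aa: "a * cnj a = m * m"
    by (simp add: m_def complex_norm_square[symmetric] power2_eq_square[symmetric])
  have "m / a * ((a - z) / (1 - cnj a * z)) = m * (a - z) / (a * cnj a * (b - z))"
    by (simp add: ab)
  also have "\<dots> = (a - z) / (m * (b - z))"
    using m by (simp add: aa)
  also have "\<dots> - 1 = (a - b) / (m * (b - z)) + (1 - m) / m"
    using m bz by (simp add: field_simps)
  finally show ?thesis
    by (simp add: m_def b_def)
qed

text \<open>\<open>M j\<close> bounds the ratio of the gap between zero and pole to the distance
  from the pole. With the Blaschke condition, the factors minus one are dominated by a summable
  sequence, so the partial products, rational with poles off \<open>K\<close>, converge
  uniformly.\<close>

lemma blaschke_product_uniform_limit:
  assumes a: "\<And>j. a (Suc j) \<in> ball 0 1 - {0}"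
    and blaschke: "summable (\<lambda>j. 1 - cmod (a (Suc j)))"
    and K: "compact K" "K \<inter> blaschke_poles a = {}"
    and M: "summable M"
    and bound: "\<forall>\<^sub>F j in sequentially. \<forall>z\<in>K.
      cmod (a (Suc j) - 1 / cnj (a (Suc j))) \<le> M j * cmod (1 / cnj (a (Suc j)) - z)"
  shows "uniform_limit_of_rationals K (blaschke_product l a)"
proof -
  define A where "A j = a (Suc j)" for j
  define G where "G j z = of_real (cmod (A j)) / A j * ((A j - z) / (1 - cnj (A j) * z))" for j z
  have A0: "A j \<noteq> 0" and A1: "cmod (A j) < 1" for j
    using a[of j] by (auto simp: A_def)
  have pole: "z \<noteq> 1 / cnj (A j)" if "z \<in> K" for z j
  proof
    assume "z = 1 / cnj (A j)"
    then have "z \<in> blaschke_poles a"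
      unfolding blaschke_poles_def A_def by (auto intro!: image_eqI[of _ _ "Suc j"])
    with that K show False by blast
  qed
  have den: "1 - cnj (A j) * z \<noteq> 0" if "z \<in> K" for z j
    using pole[OF that, of j] A0[of j] by (auto simp: field_simps)
  have cont: "continuous_on K (G j)" for j
    unfolding G_def[abs_def] using den by (intro continuous_intros) auto
  have "(\<lambda>j. 1 - cmod (A j)) \<longlonglongrightarrow> 0"
    using blaschke unfolding A_def by (rule summable_LIMSEQ_zero)
  \<comment> \<open>Eventually |a_j| > 1/2; dividing by |a_j| then costs the factor 2 in the
    majorant.\<close>
  then have "\<forall>\<^sub>F j in sequentially. 1 - cmod (A j) < 1 / 2"
    by (rule order_tendstoD) simp
  then have "\<forall>\<^sub>F j in sequentially. \<forall>z\<in>K. norm (norm (G j z - 1)) \<le> 2 * M j + 2 * (1 - cmod (A j))"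
    using bound
  proof eventually_elim
    case (elim j)
    then have half: "1 / 2 < cmod (A j)" by simp
    show ?case
    proof
      fix z assume z: "z \<in> K"
      let ?b = "1 / cnj (A j)"
      have bz: "0 < cmod (?b - z)" using pole[OF z, of j] by simp
      have "norm (G j z - 1) \<le> cmod (A j - ?b) / (cmod (A j) * cmod (?b - z)) + (1 - cmod (A j)) / cmod (A j)"
        unfolding G_def blaschke_factor_minus_one[OF A0 pole[OF z]]
        using A1[of j] by (intro order_trans[OF norm_triangle_ineq]) (simp add: norm_mult norm_divide del: of_real_diff of_real_divide)
      also have "cmod (A j - ?b) / (cmod (A j) * cmod (?b - z)) = (cmod (A j - ?b) / cmod (?b - z)) / cmod (A j)"
        by (simp add: field_simps)
      also have "\<dots> \<le> (cmod (A j - ?b) / cmod (?b - z)) / (1 / 2)"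
        using half by (intro divide_left_mono) auto
      also have "cmod (A j - ?b) / cmod (?b - z) \<le> M j"
        using elim(2) z bz by (simp add: A_def pos_divide_le_eq)
      also have "(1 - cmod (A j)) / cmod (A j) \<le> (1 - cmod (A j)) / (1 / 2)"
        using half A1[of j] by (intro divide_left_mono) auto
      finally show "norm (norm (G j z - 1)) \<le> 2 * M j + 2 * (1 - cmod (A j))"
        by simp
    qed
  qed
  moreover have "summable (\<lambda>j. 2 * M j + 2 * (1 - cmod (A j)))"
    using blaschke M unfolding A_def by (intro summable_add summable_mult)
  ultimately have "uniform_limit K (\<lambda>n z. \<Sum>j<n. norm (G j z - 1)) (\<lambda>z. \<Sum>j. norm (G j z - 1)) sequentially"
    by (rule Weierstrass_m_test_ev)
  then have conv_sum: "uniformly_convergent_on K (\<lambda>n z. \<Sum>j<n. norm (G j z - 1))"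
    by (rule uniformly_convergentI)
  from uniformly_convergent_on_prod'[OF cont K(1) this]
  obtain H where H: "uniform_limit K (\<lambda>n z. \<Prod>j<n. G j z) H sequentially"
    by (auto simp: uniformly_convergent_on_def)
  \<comment> \<open>Absolute convergence ensures that the infinite product is the limit of its
    partial products and not a default value. Those run over \<open>{..n}\<close>, hence the shift
    by \<open>LIMSEQ_Suc\<close>.\<close>
  have H_eq: "H z = (\<Prod>j. G j z)" if z: "z \<in> K" for z
  proof -
    obtain s where "uniform_limit K (\<lambda>n z. \<Sum>j<n. norm (G j z - 1)) s sequentially"
      using conv_sum by (auto simp: uniformly_convergent_on_def)
    from tendsto_uniform_limitI[OF this z] have "summable (\<lambda>j. norm (G j z - 1))"
      by (auto simp: summable_iff_convergent convergent_def)
    then have "convergent_prod (\<lambda>j. G j z)"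
      by (intro abs_convergent_prod_imp_convergent_prod summable_imp_abs_convergent_prod)
    then have "(\<lambda>n. \<Prod>j\<le>n. G j z) \<longlonglongrightarrow> (\<Prod>j. G j z)"
      by (rule convergent_prod_LIMSEQ)
    moreover have "(\<lambda>n. \<Prod>j\<le>n. G j z) \<longlonglongrightarrow> H z"
      using LIMSEQ_Suc[OF tendsto_uniform_limitI[OF H z]] by (simp add: lessThan_Suc_atMost)
    ultimately show ?thesis by (rule LIMSEQ_unique[symmetric])
  qed
  define p where "p n = monom 1 l * (\<Prod>j<n. smult (of_real (cmod (A j)) / A j) [:A j, -1:])" for n
  define q where "q n = (\<Prod>j<n. [:1, - cnj (A j):])" for n
  have G_poly: "G j z = poly (smult (of_real (cmod (A j)) / A j) [:A j, -1:]) z / poly [:1, - cnj (A j):] z" for j z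
  proof -
    have "poly [:A j, -1:] z = A j - z" "poly [:1, - cnj (A j):] z = 1 - cnj (A j) * z"
      by simp_all
    then show ?thesis by (simp only: G_def poly_smult times_divide_eq_right)
  qed
  have pq: "poly (p n) z / poly (q n) z = z ^ l * (\<Prod>j<n. G j z)" for n z
    unfolding p_def q_def G_poly prod_dividef poly_mult poly_prod poly_monom by simp
  have q0: "poly (q n) z \<noteq> 0" if "z \<in> K" for n z
    using den[OF that] by (simp add: q_def poly_prod mult.commute)
  have cont_H: "continuous_on K H"
    by (rule uniform_limit_theorem[OF _ H]) (auto intro!: always_eventually continuous_on_prod cont)
  have "uniform_limit K (\<lambda>n z. z ^ l * (\<Prod>j<n. G j z)) (\<lambda>z. z ^ l * H z) sequentially"
    by (intro uniform_lim_mult uniform_limit_const H compact_imp_bounded compact_continuous_image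
        cont_H K continuous_intros)
  then have "uniform_limit K (\<lambda>n z. poly (p n) z / poly (q n) z) (blaschke_product l a) sequentially"
    unfolding pq
    by (rule uniform_limit_cong'[THEN iffD1, rotated 2])
      (simp_all add: H_eq blaschke_product_def G_def A_def)
  with q0 show ?thesis
    unfolding uniform_limit_of_rationals_def by (intro exI[of _ p] exI[of _ q]) simp
qed

section \<open>Choice of \<open>E\<close> and fine holomorphy of the product on the enlarged
  domain\<close>

theorem lemma6p1:
  fixes \<alpha> \<beta> :: real and a :: "nat \<Rightarrow> complex" and c :: "nat \<Rightarrow> real" and l :: nat
    and S P :: "complex set"
  assumes "\<alpha> < \<beta>" and "\<beta> < \<alpha> + 2 * pi"
    and S_def: "S = cis ` {\<alpha>..\<beta>}"
    and a_disc: "\<And>j. 1 \<le> j \<Longrightarrow> a j \<in> ball 0 1 - {0}"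
    and blaschke: "summable (\<lambda>j. 1 - cmod (a (Suc j)))"
    and accumulate: "S \<subseteq> closure (a ` {1..})"
    and P_def: "P = blaschke_poles a"
    and c_pos: "\<And>j. 1 \<le> j \<Longrightarrow> 0 < c j"
    and c_mono: "mono_on {1..} c"
    and c_sum: "summable (\<lambda>j. 1 / (real (Suc j) * c (Suc j)))"
    and a_c: "\<And>j. 1 \<le> j \<Longrightarrow> cmod (a j - 1 / cnj (a j)) = exp (- (real j * c j))"
  shows "\<exists>E. finely_open E \<and> E \<inter> S \<noteq> {} \<and>
           (\<exists>F. finely_holomorphic_on F ((UNIV - (sphere 0 1 \<union> P)) \<union> E) \<and>
                (\<forall>z \<in> UNIV - (sphere 0 1 \<union> P). F z = blaschke_product l a z))"
proof -
  \<comment> \<open>Indices start at 0 from here on. \<open>r j\<close> is the square root of the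
    distance \<open>exp (- x j)\<close> between the zero \<open>A j\<close> and the pole
    \<open>b j\<close>.\<close>
  define A where "A j = a (Suc j)" for j
  define b where "b j = 1 / cnj (A j)" for j
  define x where "x j = real (Suc j) * c (Suc j)" for j
  define r where "r j = exp (- x j / 2)" for j
  define w where "w j = 1 / x j" for j
  let ?D = "UNIV - (sphere 0 1 \<union> P)"
  have A: "A j \<in> ball 0 1 - {0}" for j
    using a_disc[of "Suc j"] by (simp add: A_def)
  have x_pos: "0 < x j" for j
    using c_pos[of "Suc j"] by (simp add: x_def)
  have diff: "cmod (A j - b j) = exp (- x j)" for j
    using a_c[of "Suc j"] by (simp add: A_def b_def x_def)
  have P: "P = range b"
  proof -
    have "{1..} = range Suc" by (auto simp: image_iff Suc_le_eq gr0_conv_Suc)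
    then show ?thesis
      unfolding P_def blaschke_poles_def b_def A_def by (simp only: image_image)
  qed
  have b_gt: "1 < cmod (b j)" for j
    using A[of j] by (simp add: b_def norm_divide)
  have b_less: "cmod (b j) < 1 + exp (- x j)" for j
    using norm_triangle_sub[of "b j" "A j"] A[of j] diff[of j] by (simp add: norm_minus_commute)
  have b_le: "cmod (b j) \<le> 2" for j
    using order_trans[OF less_imp_le[OF b_less[of j]], of 2] x_pos[of j] by simp
  have r_pos: "0 < r j" and r_le: "r j \<le> 1" and r_square: "exp (- x j) = r j * r j" for j
    using x_pos[of j] by (auto simp: r_def simp flip: exp_add)
  \<comment> \<open>As \<open>c\<close> increases, \<open>x j\<close> is at least
    \<open>real j * c 1\<close>, so a geometric series dominates \<open>r\<close>.\<close>
  have r_summable: "summable r"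
  proof (rule summable_comparison_test)
    have "r j \<le> exp (- c 1 / 2) ^ j" for j
    proof -
      have "c 1 \<le> c (Suc j)"
        using c_mono by (rule mono_onD) auto
      then have "real j * c 1 \<le> x j"
        unfolding x_def using c_pos[of 1] by (intro mult_mono) auto
      then show ?thesis by (simp add: r_def flip: exp_of_nat_mult)
    qed
    then show "\<exists>N. \<forall>n\<ge>N. norm (r n) \<le> exp (- c 1 / 2) ^ n"
      using abs_of_pos[OF r_pos] by simp
    show "summable (\<lambda>n. exp (- c 1 / 2) ^ n)"
      using c_pos[of 1] by (intro summable_geometric) auto
  qed
  then have r_lim: "r \<longlonglongrightarrow> 0"
    by (rule summable_LIMSEQ_zero)
  have w_nonneg: "0 \<le> w j" for j
    using x_pos[of j] by (simp add: w_def)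
  have w_summable: "summable w"
    using c_sum by (simp add: w_def[abs_def] x_def)
  note pot = b_le r_pos r_le w_nonneg w_summable
  obtain t where t: "t \<in> {\<alpha>..\<beta>}" "summable (\<lambda>n. weighted_log b r w n (cis t))"
    using exists_summable_on_arc[of b r w, OF pot less_imp_le[OF b_gt] \<open>\<alpha> < \<beta>\<close> \<open>\<beta> < \<alpha> + 2 * pi\<close>]
    by (rule bexE)
  \<comment> \<open>The level -1/4 lies above the cut-off -1 and above -1/2, which bounds summand
    \<open>n\<close> on the disc of radius \<open>r n\<close> about \<open>b n\<close>.\<close>
  have "\<exists>N u. subharmonic (\<lambda>z. ereal (u z)) \<and> - (1 / 4) < u (cis t) \<and>
    (\<forall>z n. cmod z \<le> 2 \<longrightarrow> - (1 / 4) < u z \<longrightarrow> N \<le> n \<longrightarrow> - (1 / 4) < max (weighted_log b r w n z) (- 1))"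
    by (rule exists_subharmonic_avoiding[of b r w, OF pot _ t(2)]) simp_all
  then obtain N u where sub: "subharmonic (\<lambda>z. ereal (u z))" and u_t: "- (1 / 4) < u (cis t)"
    and u: "\<forall>z n. cmod z \<le> 2 \<longrightarrow> - (1 / 4) < u z \<longrightarrow> N \<le> n \<longrightarrow>
      - (1 / 4) < max (weighted_log b r w n z) (- 1)"
    by (elim exE conjE) (rule that)
  \<comment> \<open>The poles with index below \<open>N\<close> are not controlled by
    \<open>u\<close> and are removed by hand; the estimate from \<open>u\<close> holds in the disc
    of radius 2.\<close>
  define V where "V = ball 0 2 - b ` {..<N}"
  define E where "E = {z. - (1 / 4) < u z} \<inter> V"
  have "open V"
    unfolding V_def by (intro open_Diff finite_imp_closed) auto
  have far: "r n \<le> cmod (b n - z)" if z: "z \<in> E" and n: "N \<le> n" for z n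
  proof (rule ccontr)
    assume "\<not> ?thesis"
    then have "(cmod (z - b n))\<^sup>2 \<le> (r n)\<^sup>2"
      by (intro power_mono) (auto simp: norm_minus_commute)
    moreover have "0 < (cmod (z - b n))\<^sup>2 + (r n)\<^sup>2"
      using r_pos[of n] by (intro add_nonneg_pos) auto
    \<comment> \<open>The argument is at most 2 r_n^2; the coarser 25 r_n^2 cancels
      \<open>ln 25\<close> and leaves exactly \<open>w n / 2 * - x n\<close>, which is -1/2.\<close>
    ultimately have "ln ((cmod (z - b n))\<^sup>2 + (r n)\<^sup>2) \<le> ln (25 * (r n)\<^sup>2)"
      by (intro ln_mono) auto
    also have "\<dots> = ln 25 - x n"
      using r_pos[of n] by (simp add: ln_mult_pos ln_realpow) (simp add: r_def)
    finally have "weighted_log b r w n z \<le> w n / 2 * - x n"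
      unfolding weighted_log_def using w_nonneg[of n] by (intro mult_left_mono) auto
    also have "\<dots> = - (1 / 2)"
      using x_pos[of n] by (simp add: w_def)
    finally show False
      using u[rule_format, of z n] z n by (simp add: E_def V_def)
  qed
  have E_P: "E \<inter> P = {}"
  proof -
    have "b n \<notin> E" for n
      using far[of "b n" n] r_pos[of n] by (cases "n < N") (auto simp: E_def V_def)
    then show ?thesis by (auto simp: P)
  qed
  have rational: "uniform_limit_of_rationals K (blaschke_product l a)"
    if K: "compact K" "K \<inter> P = {}" and ev: "\<forall>\<^sub>F n in sequentially. \<forall>z\<in>K. r n \<le> cmod (b n - z)" for K
  proof (rule blaschke_product_uniform_limit[OF _ blaschke K(1) _ r_summable])
    show "a (Suc j) \<in> ball 0 1 - {0}" for j
      using A[of j] by (simp add: A_def)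
    show "K \<inter> blaschke_poles a = {}"
      using K(2) by (simp add: P_def)
    show "\<forall>\<^sub>F j in sequentially. \<forall>z\<in>K.
        cmod (a (Suc j) - 1 / cnj (a (Suc j))) \<le> r j * cmod (1 / cnj (a (Suc j)) - z)"
      using ev
    proof eventually_elim
      case (elim j)
      \<comment> \<open>The gap is \<open>r j * r j\<close>: one factor is absorbed by the distance
        to the pole, the other is the summable bound.\<close>
      have "exp (- x j) \<le> r j * cmod (b j - z)" if "z \<in> K" for z
        unfolding r_square using elim that r_pos[of j] by (intro mult_left_mono) auto
      then show ?case
        using diff[of j] by (simp add: A_def b_def)
    qed
  qed
  \<comment> \<open>The poles accumulate only on the circle, since |b_n| - 1 is at most
    \<open>r n\<close>, which tends to 0. A small disc off the circle thus meets finitely many of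
    them.\<close>
  have open_D: "open ?D"
    unfolding open_contains_ball
  proof
    fix z assume z: "z \<in> ?D"
    define d where "d = \<bar>cmod z - 1\<bar> / 2"
    have d: "0 < d" using z by (simp add: d_def)
    have "\<forall>\<^sub>F n in sequentially. r n < d"
      using r_lim d by (rule order_tendstoD(2))
    then obtain M where M: "\<And>n. M \<le> n \<Longrightarrow> r n < d"
      by (auto simp: eventually_sequentially)
    have "open (ball z d - b ` {..<M})"
      by (intro open_Diff finite_imp_closed) auto
    moreover have "z \<in> ball z d - b ` {..<M}"
      using z d by (auto simp: P)
    ultimately obtain e where e: "0 < e" "ball z e \<subseteq> ball z d - b ` {..<M}"
      by (meson open_contains_ball)
    have "ball z d - b ` {..<M} \<subseteq> ?D"
    proof
      fix y assume y: "y \<in> ball z d - b ` {..<M}"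
      have y_far: "d < \<bar>cmod y - 1\<bar>"
      proof -
        have "cmod (z - y) < d" "\<bar>cmod z - 1\<bar> = 2 * d"
          using y by (auto simp: dist_norm d_def)
        then show ?thesis
          using norm_triangle_ineq3[of z y] by linarith
      qed
      have "y \<noteq> b n" for n
      proof
        assume yb: "y = b n"
        have "M \<le> n" using y yb by (cases "n < M") auto
        moreover have "\<bar>cmod (b n) - 1\<bar> \<le> r n"
          using b_gt[of n] b_less[of n] r_square[of n]
            mult_left_le[OF r_le[of n] less_imp_le[OF r_pos[of n]]]
          by linarith
        ultimately show False
          using M[of n] y_far yb by simp
      qed
      then show "y \<in> ?D"
        using y_far d by (auto simp: P)
    qed
    with e show "\<exists>e>0. ball z e \<subseteq> ?D" by blast
  qed
  have fine_E: "finely_open E"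
    unfolding E_def by (intro openin_Int finely_open_superlevel sub open_imp_finely_open \<open>open V\<close>)
  have "finely_holomorphic_on (blaschke_product l a) (?D \<union> E)"
    unfolding finely_holomorphic_on_def
  proof (intro conjI ballI)
    show "finely_open (?D \<union> E)"
      by (intro openin_Un fine_E open_imp_finely_open open_D)
    fix z assume "z \<in> ?D \<union> E"
    then show "\<exists>K\<subseteq>?D \<union> E. fine_neighborhood z K \<and> compact K \<and> uniform_limit_of_rationals K (blaschke_product l a)"
    proof
      assume "z \<in> ?D"
      then obtain e where e: "0 < e" "ball z e \<subseteq> ?D"
        using open_D open_contains_ball by blast
      \<comment> \<open>Every pole is at least \<open>e\<close> away from \<open>z\<close>, hence at
        least \<open>e / 2\<close> away from this disc, and eventually
        \<open>r n < e / 2\<close>.\<close>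
      let ?K = "cball z (e / 2)"
      have K: "?K \<subseteq> ?D" using e by (force simp: subset_iff)
      have "fine_neighborhood z ?K"
        unfolding fine_neighborhood_def using e open_imp_finely_open[of "ball z (e / 2)"]
        by (intro exI[of _ "ball z (e / 2)"]) auto
      moreover have "uniform_limit_of_rationals ?K (blaschke_product l a)"
      proof (rule rational)
        have "\<forall>\<^sub>F n in sequentially. r n < e / 2"
          using r_lim e(1) by (intro order_tendstoD(2)) auto
        then show "\<forall>\<^sub>F n in sequentially. \<forall>y\<in>?K. r n \<le> cmod (b n - y)"
        proof eventually_elim
          case (elim n)
          have "b n \<notin> ball z e" using e(2) by (auto simp: P)
          show ?case
          proof
            fix y assume "y \<in> ?K"
            then show "r n \<le> cmod (b n - y)"
              using elim \<open>b n \<notin> ball z e\<close> dist_triangle[of z "b n" y]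
              by (simp add: dist_norm norm_minus_commute)
          qed
        qed
      qed (use K in auto)
      ultimately show ?thesis
        using K by (intro exI[of _ ?K] conjI le_supI1) simp_all
    next
      assume z: "z \<in> E"
      obtain d where d: "0 < d" "cball z d \<subseteq> V"
        using \<open>open V\<close> z open_contains_cball[of V] by (auto simp: E_def)
      \<comment> \<open>With a level strictly in between, \<open>s \<le> u y\<close> cuts out a
        compact set still inside \<open>E\<close>, while \<open>s < u y\<close> gives a finely open
        set around \<open>z\<close>.\<close>
      obtain s where s: "- (1 / 4) < s" "s < u z"
        using z dense[of "- (1 / 4)" "u z"] by (auto simp: E_def)
      let ?K = "{y. s \<le> u y} \<inter> cball z d"
      have K: "?K \<subseteq> E" using d s by (auto simp: E_def)
      have "compact ?K" by (rule compact_superlevel[OF sub])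
      moreover have "fine_neighborhood z ?K"
        unfolding fine_neighborhood_def
      proof (intro exI conjI)
        show "finely_open ({y. s < u y} \<inter> ball z d)"
          by (intro openin_Int finely_open_superlevel sub open_imp_finely_open) auto
      qed (use s d in auto)
      moreover have "uniform_limit_of_rationals ?K (blaschke_product l a)"
      proof (rule rational[OF \<open>compact ?K\<close>])
        show "?K \<inter> P = {}" using K E_P by blast
        show "\<forall>\<^sub>F n in sequentially. \<forall>y\<in>?K. r n \<le> cmod (b n - y)"
          using eventually_ge_at_top[of N] by eventually_elim (use K far in blast)
      qed
      ultimately show ?thesis
        using K by (intro exI[of _ ?K] conjI le_supI2) simp_all
    qed
  qed
  moreover have "cis t \<in> E \<inter> S"
  proof -
    have "cis t \<noteq> b n" for n
      using b_gt[of n] by (metis less_irrefl norm_cis)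
    then show ?thesis
      using u_t t(1) by (auto simp: E_def V_def S_def)
  qed
  ultimately show ?thesis
    using fine_E by (intro exI[of _ E] exI[of _ "blaschke_product l a"]) auto
qed

end
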